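(* Let $m\ge 1$, let $[\phi_i^L,\phi_i^U]$, $i=1,\dots,m$, be real intervals ($\phi_i^L\le\phi_i^U$) and let $D^L\le D^U$ be real numbers. Assume that $\min_{i=1,\dots,m}\phi_i^L\ge 0$ and $$\sum_{i=1}^m \phi_i^L\le D^L,\qquad \sum_{i=1}^m\phi_i^U\ge D^U .$$ For $k\in\{1,\dots,m\}$ let $\tilde\phi_k^L=\min \phi_k$ and $\tilde\phi_k^U=\max\phi_k$, where the minimum and the maximum are taken over all $(\phi_1,\dots,\phi_m)\in\mathbb{R}^m$ satisfying $$D^L\le\sum_{i=1}^m\phi_i\le D^U,\qquad \phi_i^L\le\phi_i\le\phi_i^U,\ i=1,\dots,m .$$ Then for all $k\in\{1,\dots,m\}$ $$\tilde\phi_k^U=\min\left(\phi_k^U,\ D^U-\sum_{i=1,\,i\ne k}^m\phi_i^L\right),\qquad \tilde\phi_k^L=\max\left(\phi_k^L,\ D^L-\sum_{i=1,\,i\ne k}^m\phi_i^U\right).$$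
   Context: The numbers $\phi_i^L,\phi_i^U$ are lower and upper bounds for the (interval-valued) Shapley value $\phi_i$ of feature $i$, and $D^L,D^U$ are lower and upper bounds for the total gain $\sum_i\phi_i$. For the statement only the linear optimization problems written in the claim matter. *)

theory Defs
  imports "HOL-Analysis.Analysis"
begin

definition feasible :: "real ^ 'm \<Rightarrow> real ^ 'm \<Rightarrow> real \<Rightarrow> real \<Rightarrow> (real ^ 'm) set" where
  "feasible \<phi>L \<phi>U DL DU =
     {\<phi>. DL \<le> (\<Sum>i\<in>UNIV. \<phi> $ i) \<and> (\<Sum>i\<in>UNIV. \<phi> $ i) \<le> DU \<and>
         (\<forall>i. \<phi>L $ i \<le> \<phi> $ i \<and> \<phi> $ i \<le> \<phi>U $ i)}"

(* "v is the minimum/maximum of f over S" includes attainment: in particular S is nonempty.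
   The HOL functions Inf, Sup, Min, Max, Least, Greatest do not by themselves assert this. *)
definition is_minimum_over :: "('a \<Rightarrow> real) \<Rightarrow> 'a set \<Rightarrow> real \<Rightarrow> bool" where
  "is_minimum_over f S v \<longleftrightarrow> (\<exists>x\<in>S. f x = v) \<and> (\<forall>x\<in>S. v \<le> f x)"

definition is_maximum_over :: "('a \<Rightarrow> real) \<Rightarrow> 'a set \<Rightarrow> real \<Rightarrow> bool" where
  "is_maximum_over f S v \<longleftrightarrow> (\<exists>x\<in>S. f x = v) \<and> (\<forall>x\<in>S. f x \<le> v)"

end

theory Submission
  imports Defs
begin

text \<open>
  Fix the coordinate \<open>k\<close> to a value \<open>v\<close>. On the segment between the lower and the upper
  corner of the box of the remaining coordinates, their sum takes every value between its smallest
  and its largest one. So \<open>v\<close> is attained on the feasible set iff four linear inequalities in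
  \<open>v\<close> hold, and the two extreme solutions are the claimed formulas.
\<close>

text \<open>One parameter \<open>t\<close> shared by all coordinates makes the sum affine in
  \<open>t\<close>, so a prescribed value \<open>s\<close> determines \<open>t\<close>.\<close>

lemma sum_segment_attained:
  fixes l u :: "'a \<Rightarrow> real"
  assumes le: "\<And>i. i \<in> A \<Longrightarrow> l i \<le> u i" and s: "sum l A \<le> s" "s \<le> sum u A"
  obtains x where "\<And>i. i \<in> A \<Longrightarrow> l i \<le> x i \<and> x i \<le> u i" "sum x A = s"
proof -
  \<comment> \<open>If the two sums agree, then \<open>t = 0 / 0 = 0\<close>, which is still correct.\<close>
  define t where "t = (s - sum l A) / (sum u A - sum l A)"
  have t: "0 \<le> t" "t \<le> 1"
    using s by (auto simp: t_def divide_le_eq_1)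
  define x where "x = (\<lambda>i. l i + t * (u i - l i))"
  have "l i \<le> x i \<and> x i \<le> u i" if "i \<in> A" for i
    using le[OF that] t mult_right_mono[of t 1 "u i - l i"] by (simp add: x_def)
  moreover have "sum x A = sum l A + t * (sum u A - sum l A)"
    by (simp add: x_def sum.distrib sum_subtractf flip: sum_distrib_left)
  then have "sum x A = s"
    using s by (simp add: t_def)
  ultimately show thesis
    using that by blast
qed

text \<open>The other coordinates must sum to a value both in \<open>[DL - v, DU - v]\<close> and
  between the sums of their bounds. The last two inequalities say that these two intervals
  meet.\<close>

lemma feasible_coordinate_iff:
  fixes \<phi>L \<phi>U :: "real ^ 'm"
  assumes le: "\<And>i. \<phi>L $ i \<le> \<phi>U $ i" and D: "DL \<le> DU"
  shows "(\<exists>\<phi>\<in>feasible \<phi>L \<phi>U DL DU. \<phi> $ k = v) \<longleftrightarrow>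
           \<phi>L $ k \<le> v \<and> v \<le> \<phi>U $ k \<and>
           DL - (\<Sum>i\<in>UNIV - {k}. \<phi>U $ i) \<le> v \<and> v \<le> DU - (\<Sum>i\<in>UNIV - {k}. \<phi>L $ i)"
    (is "?attained \<longleftrightarrow> ?ineqs")
proof
  assume ?attained
  then obtain \<phi> where \<phi>: "\<phi> \<in> feasible \<phi>L \<phi>U DL DU" "\<phi> $ k = v"
    by blast
  have "(\<Sum>i\<in>UNIV. \<phi> $ i) = v + (\<Sum>i\<in>UNIV - {k}. \<phi> $ i)"
    using \<phi>(2) sum.remove[of UNIV k "($) \<phi>"] by simp
  moreover have "(\<Sum>i\<in>UNIV - {k}. \<phi>L $ i) \<le> (\<Sum>i\<in>UNIV - {k}. \<phi> $ i)"
    "(\<Sum>i\<in>UNIV - {k}. \<phi> $ i) \<le> (\<Sum>i\<in>UNIV - {k}. \<phi>U $ i)"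
    using \<phi>(1) by (auto simp: feasible_def intro!: sum_mono)
  ultimately show ?ineqs
    using \<phi> by (auto simp: feasible_def)
next
  assume v: ?ineqs
  \<comment> \<open>The least point of the intersection: the larger of the two left ends. That
    \<open>v + s\<close> stays below \<open>DU\<close> follows from the last inequality on
    \<open>v\<close> or from \<open>DL \<le> DU\<close>, depending on which end is larger.\<close>
  define s where "s = max (\<Sum>i\<in>UNIV - {k}. \<phi>L $ i) (DL - v)"
  have "(\<Sum>i\<in>UNIV - {k}. \<phi>L $ i) \<le> (\<Sum>i\<in>UNIV - {k}. \<phi>U $ i)"
    by (intro sum_mono le)
  then have s: "(\<Sum>i\<in>UNIV - {k}. \<phi>L $ i) \<le> s" "s \<le> (\<Sum>i\<in>UNIV - {k}. \<phi>U $ i)"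
    using v unfolding s_def by linarith+
  obtain x where x: "\<And>i. i \<in> UNIV - {k} \<Longrightarrow> \<phi>L $ i \<le> x i \<and> x i \<le> \<phi>U $ i"
    and sum_x: "sum x (UNIV - {k}) = s"
    using le by (rule sum_segment_attained[OF _ s]) blast
  define \<phi> :: "real ^ 'm" where "\<phi> = (\<chi> i. if i = k then v else x i)"
  have "(\<Sum>i\<in>UNIV - {k}. \<phi> $ i) = s"
    unfolding sum_x[symmetric] by (intro sum.cong) (auto simp: \<phi>_def)
  then have "(\<Sum>i\<in>UNIV. \<phi> $ i) = v + s"
    using sum.remove[of UNIV k "($) \<phi>"] by (simp add: \<phi>_def)
  then have "\<phi> \<in> feasible \<phi>L \<phi>U DL DU"
    using v x D by (auto simp: feasible_def s_def \<phi>_def)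
  then show ?attained
    by (intro bexI[of _ \<phi>]) (simp_all add: \<phi>_def)
qed

theorem proposition1:
  fixes \<phi>L \<phi>U :: "real ^ 'm" and DL DU :: real
  assumes "\<And>i. \<phi>L $ i \<le> \<phi>U $ i"
    and "DL \<le> DU"
    and "(MIN i. \<phi>L $ i) \<ge> 0"
    and "(\<Sum>i\<in>UNIV. \<phi>L $ i) \<le> DL"
    and "(\<Sum>i\<in>UNIV. \<phi>U $ i) \<ge> DU"
  shows "\<forall>k. is_maximum_over (\<lambda>\<phi>. \<phi> $ k) (feasible \<phi>L \<phi>U DL DU)
               (min (\<phi>U $ k) (DU - (\<Sum>i\<in>UNIV - {k}. \<phi>L $ i))) \<and>
             is_minimum_over (\<lambda>\<phi>. \<phi> $ k) (feasible \<phi>L \<phi>U DL DU)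
               (max (\<phi>L $ k) (DL - (\<Sum>i\<in>UNIV - {k}. \<phi>U $ i)))"
proof
  fix k
  let ?F = "feasible \<phi>L \<phi>U DL DU"
  note iff = feasible_coordinate_iff[OF assms(1,2), of k]
  \<comment> \<open>With coordinate \<open>k\<close> split off, the hypotheses on the total sums
    bound \<open>\<phi>L $ k\<close> by the upper candidate \<open>DU - ...\<close> and
    \<open>\<phi>U $ k\<close> from below by the lower candidate \<open>DL - ...\<close>.\<close>
  have sums: "(\<Sum>i\<in>UNIV. \<phi>L $ i) = \<phi>L $ k + (\<Sum>i\<in>UNIV - {k}. \<phi>L $ i)"
    "(\<Sum>i\<in>UNIV. \<phi>U $ i) = \<phi>U $ k + (\<Sum>i\<in>UNIV - {k}. \<phi>U $ i)"
    by (rule sum.remove; simp)+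
  \<comment> \<open>Together with \<open>DL \<le> DU\<close> this compares the two candidates
    themselves. Now each lower bound on \<open>v\<close> is below each upper one.\<close>
  have rest: "(\<Sum>i\<in>UNIV - {k}. \<phi>L $ i) \<le> (\<Sum>i\<in>UNIV - {k}. \<phi>U $ i)"
    by (intro sum_mono assms(1))
  have bounds: "\<phi>L $ k \<le> \<phi> $ k \<and> \<phi> $ k \<le> \<phi>U $ k \<and>
      DL - (\<Sum>i\<in>UNIV - {k}. \<phi>U $ i) \<le> \<phi> $ k \<and> \<phi> $ k \<le> DU - (\<Sum>i\<in>UNIV - {k}. \<phi>L $ i)"
    if "\<phi> \<in> ?F" for \<phi>
    using that iff[of "\<phi> $ k"] by blast
  \<comment> \<open>Rewriting with \<open>iff\<close> reduces attainment to the four inequalities at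
    the smaller upper bound; \<open>bounds\<close> gives optimality.\<close>
  have "is_maximum_over (\<lambda>\<phi>. \<phi> $ k) ?F (min (\<phi>U $ k) (DU - (\<Sum>i\<in>UNIV - {k}. \<phi>L $ i)))"
    unfolding is_maximum_over_def iff
    using bounds rest sums assms(1)[of k] assms(2,4,5) by (intro conjI ballI; fastforce simp: min_def)
  moreover have "is_minimum_over (\<lambda>\<phi>. \<phi> $ k) ?F (max (\<phi>L $ k) (DL - (\<Sum>i\<in>UNIV - {k}. \<phi>U $ i)))"
    unfolding is_minimum_over_def iff
    using bounds rest sums assms(1)[of k] assms(2,4,5) by (intro conjI ballI; fastforce simp: max_def)
  ultimately show "is_maximum_over (\<lambda>\<phi>. \<phi> $ k) ?F
        (min (\<phi>U $ k) (DU - (\<Sum>i\<in>UNIV - {k}. \<phi>L $ i))) \<and>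
      is_minimum_over (\<lambda>\<phi>. \<phi> $ k) ?F
        (max (\<phi>L $ k) (DL - (\<Sum>i\<in>UNIV - {k}. \<phi>U $ i)))" ..
qed

end
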